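(* Let $(I,\delta,\Lambda)$ be a generalized $\mathcal{P}$-configuration, $I=[a_0,a_N]$, that has a $\Lambda$-weak attractor in $I\setminus\Lambda$. Then for any $h\in C^2(I)$ with $h(a_0)=h(a_N)$, and for any $\mu\in\mathbb{R}$ and $c\in[a_0,a_N]$, there exists a unique solution $f\in C^2(I)$ of the problem $$f(t)-\sum_{i=1}^N f(\delta_i(t))=h(t),\quad t\in I,\qquad f'(c)=\mu .$$
   Context: Generalized $\mathcal{P}$-configuration: let $a_0<a_1<\dots<a_N$ be points in $\mathbb{R}$ and $I=[a_0,a_N]$. Let $\delta_1,\dots,\delta_N$ be $C^2$ functions on $I$ such that $\delta_i$ maps $I$ onto $[a_{i-1},a_i]$, $\sum_{i=1}^N\delta_i'(t)=1$ and $\delta_i'(t)\ge 0$ for all $t\in I$ and all $i$, and $\delta_i(a_0)=a_{i-1}$, $\delta_i(a_N)=a_i$ for all $i$. The guiding sets are $\Lambda_i=\{t\in I:\delta_i'(t)=0\}$, $i=1,\dots,N$; $\Lambda$ denotes the family $(\Lambda_1,\dots,\Lambda_N)$ and, when used as a set (as in $I\setminus\Lambda$), the union $\bigcup_{i=1}^N\Lambda_i$. A $\Lambda$-proper orbit emanating from $t_1$ is a finite or infinite sequence $(t_1,t_2,\dots)$ in $I$ such that for every $j\ge 2$ there is an index $i$ with $t_{j-1}\notin\Lambda_i$ and $t_j=\delta_i(t_{j-1})$. $\Lambda\text{-}OS(t)$ is the set of all $s$ for which there is a finite $\Lambda$-proper orbit $(t,\dots,s)$ (the one-term orbit $(t)$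 is allowed). A point $t_0\in I$ is a $\Lambda$-weak attractor if $t_0\in\bigcap_{t\in I}\overline{\Lambda\text{-}OS(t)}$. *)

theory Defs
  imports "HOL-Analysis.Analysis"
begin

text \<open>
  Functions on the interval \<open>I = [a\<^sub>0, a\<^sub>N]\<close> are represented by total functions
  \<open>real \<Rightarrow> real\<close> of which only the values on \<open>I\<close> matter. Derivatives are taken within
  \<open>I\<close>, hence one-sided at the endpoints.
\<close>

abbreviation deriv_within :: "(real \<Rightarrow> real) \<Rightarrow> real set \<Rightarrow> real \<Rightarrow> real" where
  "deriv_within f S t \<equiv> vector_derivative f (at t within S)"

definition C2_on :: "real set \<Rightarrow> (real \<Rightarrow> real) \<Rightarrow> bool" where
  "C2_on S f \<longleftrightarrow>
     (\<exists>f' f''. (\<forall>t\<in>S. (f has_real_derivative f' t) (at t within S)) \<and>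
               (\<forall>t\<in>S. (f' has_real_derivative f'' t) (at t within S)) \<and>
               continuous_on S f'')"

definition P_configuration :: "nat \<Rightarrow> (nat \<Rightarrow> real) \<Rightarrow> (nat \<Rightarrow> real \<Rightarrow> real) \<Rightarrow> bool" where
  "P_configuration N a \<delta> \<longleftrightarrow>
     1 \<le> N \<and>
     strict_mono_on {0..N} a \<and>
     (\<forall>i\<in>{1..N}. C2_on {a 0..a N} (\<delta> i)) \<and>
     (\<forall>i\<in>{1..N}. \<delta> i ` {a 0..a N} = {a (i - 1)..a i}) \<and>
     (\<forall>t\<in>{a 0..a N}. (\<Sum>i=1..N. deriv_within (\<delta> i) {a 0..a N} t) = 1) \<and>
     (\<forall>i\<in>{1..N}. \<forall>t\<in>{a 0..a N}. 0 \<le> deriv_within (\<delta> i) {a 0..a N} t) \<and>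
     (\<forall>i\<in>{1..N}. \<delta> i (a 0) = a (i - 1) \<and> \<delta> i (a N) = a i)"

definition guiding_set :: "real set \<Rightarrow> (nat \<Rightarrow> real \<Rightarrow> real) \<Rightarrow> nat \<Rightarrow> real set" where
  "guiding_set I \<delta> i = {t \<in> I. deriv_within (\<delta> i) I t = 0}"

text \<open>
  In the following definitions \<open>\<Lambda>\<close> is an arbitrary family of guiding sets, indexed by
  \<open>{1..N}\<close>. Only finite orbits are needed, since orbit sets and weak attractors do not
  refer to infinite ones.
\<close>

definition proper_orbit ::
  "real set \<Rightarrow> nat \<Rightarrow> (nat \<Rightarrow> real \<Rightarrow> real) \<Rightarrow> (nat \<Rightarrow> real set) \<Rightarrow> real list \<Rightarrow> bool" where
  "proper_orbit I N \<delta> \<Lambda> ts \<longleftrightarrow>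
     ts \<noteq> [] \<and> set ts \<subseteq> I \<and>
     (\<forall>j. Suc j < length ts \<longrightarrow>
        (\<exists>i\<in>{1..N}. ts ! j \<notin> \<Lambda> i \<and> ts ! Suc j = \<delta> i (ts ! j)))"

definition orbit_set ::
  "real set \<Rightarrow> nat \<Rightarrow> (nat \<Rightarrow> real \<Rightarrow> real) \<Rightarrow> (nat \<Rightarrow> real set) \<Rightarrow> real \<Rightarrow> real set" where
  "orbit_set I N \<delta> \<Lambda> t = {s. \<exists>ts. proper_orbit I N \<delta> \<Lambda> ts \<and> hd ts = t \<and> last ts = s}"

definition weak_attractor ::
  "real set \<Rightarrow> nat \<Rightarrow> (nat \<Rightarrow> real \<Rightarrow> real) \<Rightarrow> (nat \<Rightarrow> real set) \<Rightarrow> real \<Rightarrow> bool" where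
  "weak_attractor I N \<delta> \<Lambda> t0 \<longleftrightarrow>
     t0 \<in> I \<and> t0 \<in> (\<Inter>t\<in>I. closure (orbit_set I N \<delta> \<Lambda> t))"

end

theory Submission
  imports Defs "HOL-Complex_Analysis.Great_Picard"
begin

text \<open>
  Differentiating the equation gives \<open>g - T g = h'\<close> for \<open>g = f'\<close>, where \<open>T g = \<Sum>\<^sub>i \<delta>\<^sub>i' (g \<circ> \<delta>\<^sub>i)\<close> is a
  Markov operator; the condition \<open>h(a\<^sub>0) = h(a\<^sub>N)\<close> says that \<open>h'\<close> has mean zero, a property that \<open>T\<close>
  preserves. By the maximum principle the set where a fixed point of \<open>T\<close> attains its maximum contains the
  attractor, and likewise for the minimum, so the continuous fixed points of \<open>T\<close> are the constants.
  The leading part \<open>S w = \<Sum>\<^sub>i (\<delta>\<^sub>i')\<^sup>2 (w \<circ> \<delta>\<^sub>i)\<close> of \<open>(T g)'\<close> is a contraction in a weighted sup norm,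
  because from every point some path reaches a neighbourhood of the attractor, where the walk really
  branches. Hence \<open>T\<close> is power bounded in \<open>C\<^sup>1\<close>, and by Arzela-Ascoli and the uniqueness of fixed points
  \<open>1 - T\<close> is bounded below on mean-zero functions. The double Cesaro means
  \<open>(1/n) \<Sum>\<^sub>m\<^sub><\<^sub>n \<Sum>\<^sub>j\<^sub><\<^sub>m T\<^sup>j h'\<close> solve the equation up to an error of order \<open>1/n\<close>, so they converge in \<open>C\<^sup>1\<close> to a
  solution.
\<close>

text \<open>
  Here \<open>p i\<close> and \<open>q i\<close> are the first two derivatives of \<open>\<delta>\<^sub>i\<close>, and of the weak attractor only its
  membership in every nonempty closed set invariant under proper steps is retained.
\<close>

locale branching_config =
  fixes lo hi :: real and J :: "nat set" and d p q :: "nat \<Rightarrow> real \<Rightarrow> real" and t0 :: real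
  assumes lo_less_hi: "lo < hi"
    and finite_J: "finite J"
    and d_in: "\<And>i t. i \<in> J \<Longrightarrow> t \<in> {lo..hi} \<Longrightarrow> d i t \<in> {lo..hi}"
    and d_deriv: "\<And>i t. i \<in> J \<Longrightarrow> t \<in> {lo..hi} \<Longrightarrow>
          (d i has_real_derivative p i t) (at t within {lo..hi})"
    and p_deriv: "\<And>i t. i \<in> J \<Longrightarrow> t \<in> {lo..hi} \<Longrightarrow>
          (p i has_real_derivative q i t) (at t within {lo..hi})"
    and q_cont: "\<And>i. i \<in> J \<Longrightarrow> continuous_on {lo..hi} (q i)"
    and p_nonneg: "\<And>i t. i \<in> J \<Longrightarrow> t \<in> {lo..hi} \<Longrightarrow> 0 \<le> p i t"
    and p_sum: "\<And>t. t \<in> {lo..hi} \<Longrightarrow> (\<Sum>i\<in>J. p i t) = 1"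
    and telescope: "\<And>F :: real \<Rightarrow> real. (\<Sum>i\<in>J. F (d i hi) - F (d i lo)) = F hi - F lo"
    and p_t0_pos: "\<And>i. i \<in> J \<Longrightarrow> 0 < p i t0"
    and attractor: "\<And>Z. closed Z \<Longrightarrow> Z \<subseteq> {lo..hi} \<Longrightarrow> Z \<noteq> {} \<Longrightarrow>
          (\<And>t i. t \<in> Z \<Longrightarrow> i \<in> J \<Longrightarrow> p i t \<noteq> 0 \<Longrightarrow> d i t \<in> Z) \<Longrightarrow> t0 \<in> Z"
    and card_J: "2 \<le> card J"
begin

abbreviation I :: "real set" where "I \<equiv> {lo..hi}"

section \<open>The averaging operator and the two parts of its derivative\<close>

definition T :: "(real \<Rightarrow> real) \<Rightarrow> real \<Rightarrow> real" where
  "T g t = (\<Sum>i\<in>J. p i t * g (d i t))"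

definition S :: "(real \<Rightarrow> real) \<Rightarrow> real \<Rightarrow> real" where
  "S w t = (\<Sum>i\<in>J. (p i t)\<^sup>2 * w (d i t))"

definition B :: "(real \<Rightarrow> real) \<Rightarrow> real \<Rightarrow> real" where
  "B g t = (\<Sum>i\<in>J. q i t * g (d i t))"

lemma d_cont: "i \<in> J \<Longrightarrow> continuous_on I (d i)"
  by (metis DERIV_continuous_on d_deriv)

lemma p_cont: "i \<in> J \<Longrightarrow> continuous_on I (p i)"
  by (metis DERIV_continuous_on p_deriv)

lemma comp_d_cont:
  assumes "continuous_on I g" "i \<in> J"
  shows "continuous_on I (\<lambda>t. g (d i t))"
  by (rule continuous_on_compose2[OF assms(1) d_cont[OF assms(2)]]) (use d_in assms(2) in blast)

lemma S_cont: "continuous_on I g \<Longrightarrow> continuous_on I (S g)"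
  unfolding S_def[abs_def] by (intro continuous_intros p_cont comp_d_cont)

lemma B_cont: "continuous_on I g \<Longrightarrow> continuous_on I (B g)"
  unfolding B_def[abs_def] by (intro continuous_intros q_cont comp_d_cont)

lemma comp_d_deriv:
  assumes "\<And>t. t \<in> I \<Longrightarrow> (g has_real_derivative g' t) (at t within I)" "i \<in> J" "t \<in> I"
  shows "((\<lambda>t. g (d i t)) has_real_derivative g' (d i t) * p i t) (at t within I)"
proof -
  have "(g has_real_derivative g' (d i t)) (at (d i t) within d i ` I)"
    by (rule DERIV_subset[OF assms(1)]) (use d_in assms in blast)+
  from DERIV_image_chain[OF this d_deriv] assms(2,3) show ?thesis
    by (simp add: o_def)
qed

text \<open>The chain rule puts the weight \<open>p i\<close> in front of each branch, so the sum
  over branches in the functional equation differentiates to \<open>T\<close>.\<close>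

lemma sum_comp_d_deriv:
  assumes "\<And>t. t \<in> I \<Longrightarrow> (f has_real_derivative g t) (at t within I)" "t \<in> I"
  shows "((\<lambda>t. \<Sum>i\<in>J. f (d i t)) has_real_derivative T g t) (at t within I)"
  unfolding T_def
  by (rule DERIV_sum) (use comp_d_deriv[OF assms(1)] assms(2) in \<open>simp add: mult.commute\<close>)

text \<open>One factor \<open>p i\<close> is the weight in \<open>T\<close> and a second comes from
  the chain rule, whence the squares in \<open>S\<close>. Differentiating the weight itself gives
  \<open>B\<close>, which involves only the values of \<open>g\<close>.\<close>

lemma T_deriv:
  assumes "\<And>t. t \<in> I \<Longrightarrow> (g has_real_derivative g' t) (at t within I)" "t \<in> I"
  shows "(T g has_real_derivative S g' t + B g t) (at t within I)"
proof -
  have "(T g has_real_derivative (\<Sum>i\<in>J. q i t * g (d i t) + g' (d i t) * p i t * p i t)) (at t within I)"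
    unfolding T_def[abs_def]
    by (intro DERIV_sum DERIV_mult p_deriv comp_d_deriv[OF assms(1)] assms(2))
  then show ?thesis
    by (simp add: S_def B_def sum.distrib[symmetric] power2_eq_square algebra_simps)
qed

lemma T_scale: "T (\<lambda>t. r * g t) t = r * T g t"
  by (simp add: T_def algebra_simps sum_distrib_left)
lemma S_scale: "S (\<lambda>t. r * g t) t = r * S g t"
  by (simp add: S_def algebra_simps sum_distrib_left)
lemma T_lin: "T (\<lambda>t. r * f t + s * g t) t = r * T f t + s * T g t"
  by (simp add: T_def algebra_simps sum.distrib sum_distrib_left)

lemma T_sum: "T (\<lambda>t. \<Sum>m<n. G m t) t = (\<Sum>m<(n::nat). T (G m) t)"
  unfolding T_def by (simp add: sum_distrib_left sum.swap[of _ J])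

lemma T_const: "t \<in> I \<Longrightarrow> T (\<lambda>_. c) t = c"
  using p_sum by (simp add: T_def sum_distrib_right[symmetric])

lemma T_mono: "\<lbrakk>\<And>x. x \<in> I \<Longrightarrow> f x \<le> g x; t \<in> I\<rbrakk> \<Longrightarrow> T f t \<le> T g t"
  unfolding T_def by (intro sum_mono mult_left_mono p_nonneg) (use d_in in blast)+

lemma S_mono: "\<lbrakk>\<And>x. x \<in> I \<Longrightarrow> f x \<le> g x; t \<in> I\<rbrakk> \<Longrightarrow> S f t \<le> S g t"
  unfolding S_def by (intro sum_mono mult_left_mono) (use d_in in force)+

lemma abs_T_le:
  assumes "\<And>x. x \<in> I \<Longrightarrow> \<bar>g x\<bar> \<le> M" "t \<in> I"
  shows "\<bar>T g t\<bar> \<le> M"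
proof -
  have "T g t \<le> T (\<lambda>_. M) t" "T (\<lambda>_. - M) t \<le> T g t"
    using assms by (intro T_mono; force)+
  then show ?thesis using assms T_const by (simp add: abs_le_iff)
qed

text \<open>Comparison with multiples of \<open>\<phi>\<close> is how the weighted sup norm is
  handled, without introducing a norm.\<close>

lemma abs_S_le:
  assumes "\<And>x. x \<in> I \<Longrightarrow> \<bar>w x\<bar> \<le> M * \<phi> x" "t \<in> I"
  shows "\<bar>S w t\<bar> \<le> M * S \<phi> t"
proof -
  have "S w t \<le> S (\<lambda>x. M * \<phi> x) t" "S (\<lambda>x. (- M) * \<phi> x) t \<le> S w t"
    using assms by (intro S_mono; force)+
  then show ?thesis unfolding S_scale by (simp add: abs_le_iff)
qed

lemma p_le_1: "i \<in> J \<Longrightarrow> t \<in> I \<Longrightarrow> p i t \<le> 1"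
  using p_sum[of t] member_le_sum[of i J "\<lambda>i. p i t"] p_nonneg finite_J by auto

lemma S_one_le: "t \<in> I \<Longrightarrow> S (\<lambda>_. 1) t \<le> 1"
proof -
  assume t: "t \<in> I"
  have "S (\<lambda>_. 1) t \<le> (\<Sum>i\<in>J. p i t)"
    unfolding S_def
    by (rule sum_mono) (use p_le_1 p_nonneg t in \<open>simp add: power2_eq_square mult_left_le\<close>)
  then show ?thesis using p_sum t by simp
qed

text \<open>The functions \<open>q i\<close> are bounded on the compact interval, so
  \<open>B\<close> is bounded in the sup norm, with \<open>C\<close> independent of
  \<open>g\<close>.\<close>

lemma B_bound: "\<exists>C\<ge>0. \<forall>g M. (\<forall>t\<in>I. \<bar>g t\<bar> \<le> M) \<longrightarrow> (\<forall>t\<in>I. \<bar>B g t\<bar> \<le> C * M)"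
proof -
  have "continuous_on I (\<lambda>t. \<Sum>i\<in>J. \<bar>q i t\<bar>)"
    by (intro continuous_intros q_cont)
  then have "bounded ((\<lambda>t. \<Sum>i\<in>J. \<bar>q i t\<bar>) ` I)"
    using compact_continuous_image compact_imp_bounded by blast
  then obtain C where C: "\<And>t. t \<in> I \<Longrightarrow> \<bar>\<Sum>i\<in>J. \<bar>q i t\<bar>\<bar> \<le> C"
    unfolding bounded_iff by fastforce
  have "C \<ge> 0" using order.trans[OF abs_ge_zero C[of lo]] lo_less_hi by simp
  moreover have "\<bar>B g t\<bar> \<le> C * M" if g: "\<forall>t\<in>I. \<bar>g t\<bar> \<le> M" and t: "t \<in> I" for g M t
  proof -
    have "\<bar>g lo\<bar> \<le> M" using g lo_less_hi by auto
    then have "M \<ge> 0" by linarith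
    have "\<bar>B g t\<bar> \<le> (\<Sum>i\<in>J. \<bar>q i t\<bar> * M)"
      unfolding B_def
      by (rule order.trans[OF sum_abs sum_mono])
        (use g d_in t in \<open>auto simp: abs_mult intro!: mult_left_mono\<close>)
    also have "\<dots> = (\<Sum>i\<in>J. \<bar>q i t\<bar>) * M" by (simp add: sum_distrib_right)
    also have "\<dots> \<le> C * M" using C[OF t] \<open>M \<ge> 0\<close> by (intro mult_right_mono) auto
    finally show ?thesis .
  qed
  ultimately show ?thesis by blast
qed

subsection \<open>The maximum principle\<close>

text \<open>At a maximum point the value of \<open>g\<close> is an average of its values at the
  successors, so every successor of positive weight is again a maximum point. The closed set of
  maximum points is therefore invariant and contains \<open>t0\<close>.\<close>

lemma fixed_le_at_attractor:
  assumes g: "continuous_on I g" and fp: "\<And>t. t \<in> I \<Longrightarrow> T g t = g t" and s: "s \<in> I"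
  shows "g s \<le> g t0"
proof -
  obtain m where m: "m \<in> I" "\<And>x. x \<in> I \<Longrightarrow> g x \<le> g m"
    using continuous_attains_sup[OF _ _ g] lo_less_hi by auto
  have "t0 \<in> {t\<in>I. g t = g m}"
  proof (rule attractor)
    show "closed {t\<in>I. g t = g m}"
      by (rule continuous_closed_preimage_constant[OF g]) simp
    fix t i assume t: "t \<in> {t\<in>I. g t = g m}" and i: "i \<in> J" "p i t \<noteq> 0"
    have "(\<Sum>i\<in>J. p i t * (g m - g (d i t))) = 0"
      using p_sum[of t] fp[of t] t
      by (simp add: T_def right_diff_distrib sum_subtractf sum_distrib_right[symmetric])
    then have "p i t * (g m - g (d i t)) = 0"
      using i(1) t m(2) p_nonneg d_in finite_J by (subst (asm) sum_nonneg_eq_0_iff) auto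
    then show "d i t \<in> {t\<in>I. g t = g m}" using i t d_in by auto
  qed (use m in auto)
  then show ?thesis using m s by auto
qed

text \<open>The maximum principle for \<open>g\<close> and for its negative places both extreme
  values at \<open>t0\<close>.\<close>

lemma fixed_const:
  assumes g: "continuous_on I g" and fp: "\<And>t. t \<in> I \<Longrightarrow> T g t = g t" and s: "s \<in> I"
  shows "g s = g t0"
proof (rule antisym)
  show "g s \<le> g t0" by (rule fixed_le_at_attractor[OF assms])
  have "- g s \<le> - g t0"
    by (rule fixed_le_at_attractor[of "\<lambda>t. - g t"])
      (use T_scale[of "-1" g] fp s in \<open>auto intro: continuous_on_minus g\<close>)
  then show "g t0 \<le> g s" by simp
qed

subsection \<open>Contraction in the leading part of the derivative\<close>

abbreviation S_iter :: "nat \<Rightarrow> real \<Rightarrow> real" where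
  "S_iter n \<equiv> (S ^^ n) (\<lambda>_. 1)"

lemma S_iter_cont: "continuous_on I (S_iter n)"
  by (induction n) (auto intro: S_cont)

lemma S_iter_le_1: "t \<in> I \<Longrightarrow> S_iter n t \<le> 1"
proof (induction n arbitrary: t)
  case (Suc n)
  have "S (S_iter n) t \<le> S (\<lambda>_. 1) t"
    using Suc by (intro S_mono) auto
  then show ?case using S_one_le[OF Suc.prems] by simp
qed auto

lemma S_iter_antimono: "t \<in> I \<Longrightarrow> m \<le> n \<Longrightarrow> S_iter n t \<le> S_iter m t"
proof -
  have step: "S_iter (Suc n) t \<le> S_iter n t" if "t \<in> I" for n t
    using that
  proof (induction n arbitrary: t)
    case 0 then show ?case using S_one_le by simp
  next
    case (Suc n)
    have "S (S_iter (Suc n)) t \<le> S (S_iter n) t"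
      using Suc by (intro S_mono) auto
    then show ?case by simp
  qed
  assume "t \<in> I" "m \<le> n"
  from lift_Suc_antimono_le[of "\<lambda>n. S_iter n t", OF step[OF \<open>t \<in> I\<close>] \<open>m \<le> n\<close>]
  show ?thesis .
qed

text \<open>\<^term>\<open>S_iter n t\<close> is the sum of the squared probabilities of the paths of length \<open>n\<close> from \<open>t\<close>;
  it is 1 for all \<open>n\<close> only if the walk from \<open>t\<close> is deterministic, which fails near \<^term>\<open>t0\<close>.\<close>

lemma S_iter_eventually_less_1: "\<exists>n. \<forall>t\<in>I. S_iter n t < 1"
proof (rule ccontr)
  assume neg: "\<not> ?thesis"
  \<comment> \<open>Under the negated claim these compact sets are nonempty, and they decrease in
    \<open>n\<close>; from a point of their intersection the walk never branches.\<close>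
  define F where "F n = {t\<in>I. S_iter n t = 1}" for n
  have closedF: "closed (F n)" for n
    unfolding F_def by (rule continuous_closed_preimage_constant[OF S_iter_cont]) simp
  have "\<Inter>(range F) \<noteq> {}"
  proof (rule compact_nest)
    show "compact (F n)" for n
      using compact_Int_closed[OF compact_Icc closedF[of n], of lo hi]
      by (auto simp: F_def elim!: back_subst[of compact])
    show "F n \<noteq> {}" for n
    proof -
      obtain t where "t \<in> I" "\<not> S_iter n t < 1" using neg by blast
      then have "t \<in> F n" using S_iter_le_1[of t n] by (simp add: F_def)
      then show ?thesis by blast
    qed
    show "F n \<subseteq> F m" if "m \<le> n" for m n
      unfolding F_def using S_iter_antimono[OF _ that] S_iter_le_1 by (force intro: antisym)
  qed
  have "t0 \<in> \<Inter>(range F)"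
  proof (rule attractor)
    show "closed (\<Inter>(range F))" using closedF by blast
    show "\<Inter>(range F) \<subseteq> I" by (auto simp: F_def)
    fix t i assume "t \<in> \<Inter>(range F)" and i: "i \<in> J" "p i t \<noteq> 0"
    then have t: "t \<in> I" "\<And>n. S_iter n t = 1" by (auto simp: F_def)
    have "S_iter n (d i t) = 1" for n
    proof -
      \<comment> \<open>The split on the sign stands in for nonnegativity of the iterates, which is
        not at hand here.\<close>
      have nn: "0 \<le> p i t * (1 - p i t * S_iter n (d i t))" if "i \<in> J" for i
      proof -
        have "p i t * S_iter n (d i t) \<le> 1 * 1" if "S_iter n (d i t) \<ge> 0"
          using that p_nonneg p_le_1 S_iter_le_1 d_in t(1) \<open>i \<in> J\<close> by (intro mult_mono) auto
        moreover have "p i t * S_iter n (d i t) \<le> 1" if "S_iter n (d i t) \<le> 0"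
          using mult_nonneg_nonpos[OF p_nonneg[OF \<open>i \<in> J\<close> t(1)] that] by simp
        ultimately show ?thesis using p_nonneg[OF \<open>i \<in> J\<close> t(1)] by (intro mult_nonneg_nonneg) force+
      qed
      \<comment> \<open>Both \<open>S_iter (Suc n) t\<close> and the sum of the weights equal 1.
        Their difference is this sum of nonnegative terms, so each term vanishes.\<close>
      have "(\<Sum>i\<in>J. p i t * (1 - p i t * S_iter n (d i t))) = 0"
        using p_sum[OF t(1)] t(2)[of "Suc n"]
        by (simp add: S_def power2_eq_square right_diff_distrib sum_subtractf mult.assoc)
      then have "p i t * (1 - p i t * S_iter n (d i t)) = 0"
        using i nn finite_J by (subst (asm) sum_nonneg_eq_0_iff) auto
      then have "p i t * S_iter n (d i t) = 1" using i by simp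
      moreover have "p i t \<le> 1" "p i t > 0" "S_iter n (d i t) \<le> 1"
        using p_le_1 p_nonneg[of i t] S_iter_le_1 d_in i t by force+
      ultimately show ?thesis
        by (smt (verit) mult_left_le mult_less_cancel_left_pos)
    qed
    then show "d i t \<in> \<Inter>(range F)" using i t d_in by (auto simp: F_def)
  qed (use \<open>\<Inter>(range F) \<noteq> {}\<close> in auto)
  then have t0: "t0 \<in> I" "S_iter 1 t0 = 1" by (auto simp: F_def simp del: funpow.simps)
  \<comment> \<open>All weights at \<open>t0\<close> are positive and there are at least two, so
    none of them is 1 and the sum of their squares drops below 1, against
    \<open>S_iter 1 t0 = 1\<close>.\<close>
  have "p i t0 < 1" if i: "i \<in> J" for i
  proof -
    obtain j where j: "j \<in> J" "j \<noteq> i"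
      by (metis card_J card_le_Suc0_iff_eq finite_J i not_less_eq_eq numeral_2_eq_2)
    have "(\<Sum>k\<in>{i,j}. p k t0) \<le> (\<Sum>k\<in>J. p k t0)"
      by (rule sum_mono2) (use i j finite_J p_nonneg t0 in auto)
    then show ?thesis using p_t0_pos[OF j(1)] p_sum[OF t0(1)] j(2) by auto
  qed
  then have "(\<Sum>i\<in>J. (p i t0)\<^sup>2) < (\<Sum>i\<in>J. p i t0)"
    using p_t0_pos card_J finite_J
    by (intro sum_strict_mono) (auto simp: power2_eq_square)
  then show False using t0(2) p_sum[OF t0(1)] by (simp add: S_def)
qed

text \<open>The weight is a truncated Neumann series of \<open>S\<close> applied to 1. Applying
  \<open>S\<close> shifts it, so \<open>S \<phi> = \<phi> - 1 + S_iter n\<close>; for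
  \<open>n\<close> with \<open>S_iter n < 1\<close> on the interval, compactness makes the loss
  uniform.\<close>

lemma S_contraction_weight:
  "\<exists>\<phi> r C. continuous_on I \<phi> \<and> (\<forall>t\<in>I. 1 \<le> \<phi> t \<and> \<phi> t \<le> C \<and> S \<phi> t \<le> r * \<phi> t) \<and> 0 \<le> r \<and> r < 1"
proof -
  obtain n where n: "\<And>t. t \<in> I \<Longrightarrow> S_iter n t < 1"
    using S_iter_eventually_less_1 by blast
  have "n \<noteq> 0" using n[of lo] lo_less_hi by (intro notI) simp
  define \<phi> where "\<phi> t = (\<Sum>k<n. S_iter k t)" for t
  have \<phi>_cont: "continuous_on I \<phi>"
    unfolding \<phi>_def[abs_def] by (intro continuous_on_sum S_iter_cont)
  have S_nonneg: "0 \<le> S_iter k t" if "t \<in> I" for k t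
    using that
  proof (induction k arbitrary: t)
    case (Suc k)
    then show ?case using d_in by (auto simp: S_def[of "S_iter k"] intro!: sum_nonneg mult_nonneg_nonneg)
  qed auto
  have \<phi>_ge: "1 \<le> \<phi> t" if "t \<in> I" for t
  proof -
    have "S_iter 0 t \<le> \<phi> t"
      unfolding \<phi>_def by (rule member_le_sum) (use \<open>n \<noteq> 0\<close> S_nonneg that in auto)
    then show ?thesis by simp
  qed
  have \<phi>_le: "\<phi> t \<le> n" if "t \<in> I" for t
    unfolding \<phi>_def using sum_mono[of "{..<n}" "\<lambda>k. S_iter k t" "\<lambda>_. 1"] S_iter_le_1[OF that] by auto
  have S_sum: "S \<phi> t = (\<Sum>k<n. S_iter (Suc k) t)" for t
    unfolding \<phi>_def[abs_def] S_def
    by (simp add: S_def sum_distrib_left sum.swap[of _ J])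
  have S_\<phi>: "S \<phi> t = \<phi> t - 1 + S_iter n t" for t
  proof -
    have "(\<Sum>k<n. S_iter (Suc k) t) - (\<Sum>k<n. S_iter k t) = S_iter n t - 1"
      using sum_lessThan_telescope[of "\<lambda>k. S_iter k t" n] by (simp add: sum_subtractf)
    then show ?thesis unfolding S_sum by (simp add: \<phi>_def)
  qed
  obtain m where m: "m \<in> I" "\<And>t. t \<in> I \<Longrightarrow> S_iter n t \<le> S_iter n m"
    using continuous_attains_sup[of I "S_iter n", OF _ _ S_iter_cont] lo_less_hi by auto
  \<comment> \<open>The maximum point \<open>m\<close> gives the least loss
    \<open>1 - S_iter n m\<close>, and \<open>\<phi> \<le> n\<close> turns this additive loss into a
    proportional one.\<close>
  define r where "r = 1 - (1 - S_iter n m) / n"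
  have n1: "1 \<le> real n" using \<open>n \<noteq> 0\<close> by simp
  have "0 \<le> r" using S_nonneg[OF m(1), of n] n1 by (simp add: r_def field_simps)
  moreover have "r < 1" using n[OF m(1)] \<open>n \<noteq> 0\<close> by (simp add: r_def field_simps)
  moreover have "S \<phi> t \<le> r * \<phi> t" if t: "t \<in> I" for t
  proof -
    have "(1 - S_iter n m) * (\<phi> t / n) \<le> (1 - S_iter n m) * 1"
      using n[OF m(1)] \<phi>_le[OF t] \<open>n \<noteq> 0\<close> by (intro mult_left_mono) auto
    then have "(1 - S_iter n m) / n * \<phi> t \<le> 1 - S_iter n t"
      using m(2)[OF t] by (simp add: field_simps)
    then show ?thesis unfolding S_\<phi> r_def left_diff_distrib by linarith
  qed
  ultimately show ?thesis using \<phi>_cont \<phi>_ge \<phi>_le by blast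
qed

text \<open>If \<open>M\<close> is the maximum of \<open>\<bar>w\<bar> / \<phi>\<close>, the
  contraction gives \<open>M \<le> M * r + \<beta>\<close>, hence
  \<open>M \<le> \<beta> / (1 - r)\<close>. The bound controls derivatives once the term
  \<open>B\<close> is under control.\<close>

lemma S_resolvent_bound:
  "\<exists>C\<ge>0. \<forall>w \<beta>. continuous_on I w \<and> (\<forall>t\<in>I. \<bar>w t - S w t\<bar> \<le> \<beta>) \<longrightarrow> (\<forall>t\<in>I. \<bar>w t\<bar> \<le> C * \<beta>)"
proof -
  obtain \<phi> r C where \<phi>: "continuous_on I \<phi>" "\<And>t. t \<in> I \<Longrightarrow> 1 \<le> \<phi> t" "\<And>t. t \<in> I \<Longrightarrow> \<phi> t \<le> C"
    and r: "0 \<le> r" "r < 1" "\<And>t. t \<in> I \<Longrightarrow> S \<phi> t \<le> r * \<phi> t"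
    using S_contraction_weight by blast
  have C: "C \<ge> 1" using \<phi>(2,3)[of lo] lo_less_hi by force
  have "\<bar>w t\<bar> \<le> C / (1 - r) * \<beta>" if w: "continuous_on I w" and
    \<beta>: "\<And>t. t \<in> I \<Longrightarrow> \<bar>w t - S w t\<bar> \<le> \<beta>" and t: "t \<in> I" for w \<beta> t
  proof -
    have "continuous_on I (\<lambda>t. \<bar>w t\<bar> / \<phi> t)"
      using \<phi>(2) by (intro continuous_intros w \<phi>(1)) force
    then obtain m where m: "m \<in> I" "\<And>x. x \<in> I \<Longrightarrow> \<bar>w x\<bar> / \<phi> x \<le> \<bar>w m\<bar> / \<phi> m"
      using continuous_attains_sup[of I "\<lambda>t. \<bar>w t\<bar> / \<phi> t"] lo_less_hi by auto
    define M where "M = \<bar>w m\<bar> / \<phi> m"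
    have "M \<ge> 0" unfolding M_def using \<phi>(2)[OF m(1)] by simp
    have wM: "\<bar>w x\<bar> \<le> M * \<phi> x" if "x \<in> I" for x
      using m(2)[OF that] \<phi>(2)[OF that] unfolding M_def by (subst (asm) pos_divide_le_eq) auto
    have "\<beta> \<ge> 0" using \<beta>[OF m(1)] by linarith
    have "M * \<phi> m = \<bar>w m\<bar>" using \<phi>(2)[OF m(1)] by (simp add: M_def)
    also have "\<dots> \<le> \<bar>S w m\<bar> + \<beta>" using \<beta>[OF m(1)] by linarith
    \<comment> \<open>Since \<open>\<phi> \<ge> 1\<close>, the error may be weighted too, which lets
      \<open>\<phi> m\<close> cancel.\<close>
    also have "\<dots> \<le> M * (r * \<phi> m) + \<beta> * \<phi> m"
    proof (rule add_mono)
      show "\<bar>S w m\<bar> \<le> M * (r * \<phi> m)"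
        using abs_S_le[of w M \<phi>, OF wM m(1)] mult_left_mono[OF r(3)[OF m(1)] \<open>M \<ge> 0\<close>] by linarith
      show "\<beta> \<le> \<beta> * \<phi> m" using \<phi>(2)[OF m(1)] \<open>\<beta> \<ge> 0\<close> by (simp add: mult_left_le mult_le_cancel_left1)
    qed
    finally have "M * \<phi> m \<le> (M * r + \<beta>) * \<phi> m" by (simp add: algebra_simps)
    then have "M \<le> M * r + \<beta>" using \<phi>(2)[OF m(1)] by (simp add: mult_le_cancel_right)
    then have "M \<le> \<beta> / (1 - r)" using r by (simp add: field_simps)
    then have "M * \<phi> t \<le> \<beta> / (1 - r) * C"
      using \<phi>(2,3)[OF t] \<open>\<beta> \<ge> 0\<close> r by (intro mult_mono) auto
    then show ?thesis using wM[OF t] by (simp add: mult.commute)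
  qed
  moreover have "C / (1 - r) \<ge> 0" using C r by simp
  ultimately show ?thesis by blast
qed

subsection \<open>A priori bound\<close>

text \<open>This is the derivative of \<open>T g\<close> when \<open>g'\<close> is that of
  \<open>g\<close>. Carrying \<open>g'\<close> as a separate argument makes \<open>D\<close> linear
  in the pair.\<close>

definition D :: "(real \<Rightarrow> real) \<Rightarrow> (real \<Rightarrow> real) \<Rightarrow> real \<Rightarrow> real" where
  "D g g' t = S g' t + B g t"

lemma D_lin: "D (\<lambda>t. r * f t + s * g t) (\<lambda>t. r * f' t + s * g' t) t = r * D f f' t + s * D g g' t"
  by (simp add: D_def S_def B_def algebra_simps sum.distrib sum_distrib_left)

lemma D_sum: "D (\<lambda>t. \<Sum>m<n. G m t) (\<lambda>t. \<Sum>m<n. G' m t) t = (\<Sum>m<(n::nat). D (G m) (G' m) t)"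
  unfolding D_def S_def B_def by (simp add: sum_distrib_left sum.swap[of _ J] sum.distrib)

text \<open>The last conjunct says that \<open>g\<close> has mean zero, in a form that is visibly preserved by \<^term>\<open>T\<close>.\<close>

definition mean_zero_C1 :: "(real \<Rightarrow> real) \<Rightarrow> (real \<Rightarrow> real) \<Rightarrow> bool" where
  "mean_zero_C1 g g' \<longleftrightarrow> (\<forall>t\<in>I. (g has_real_derivative g' t) (at t within I)) \<and> continuous_on I g' \<and>
     (\<exists>F. (\<forall>t\<in>I. (F has_real_derivative g t) (at t within I)) \<and> F lo = F hi)"

lemma mean_zero_C1_D:
  assumes "mean_zero_C1 g g'"
  shows "\<And>t. t \<in> I \<Longrightarrow> (g has_real_derivative g' t) (at t within I)" "continuous_on I g'"
    "continuous_on I g"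
proof -
  show *: "\<And>t. t \<in> I \<Longrightarrow> (g has_real_derivative g' t) (at t within I)" "continuous_on I g'"
    using assms by (auto simp: mean_zero_C1_def)
  show "continuous_on I g" using *(1) by (metis DERIV_continuous_on)
qed

text \<open>Rolle's theorem for the antiderivative. The zero is what later excludes nonzero
  constants as limits.\<close>

lemma mean_zero_C1_zero:
  assumes "mean_zero_C1 g g'"
  shows "\<exists>z\<in>I. g z = 0"
proof -
  obtain F where F: "\<And>t. t \<in> I \<Longrightarrow> (F has_real_derivative g t) (at t within I)" "F lo = F hi"
    using assms unfolding mean_zero_C1_def by blast
  have "\<exists>x\<in>{lo<..<hi}. F hi - F lo = g x * (hi - lo)"
    by (rule mvt_simple[OF lo_less_hi])
      (use F(1) in \<open>auto simp: has_field_derivative_def\<close>)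
  then show ?thesis using F(2) lo_less_hi by force
qed

lemma mean_zero_C1_lin:
  assumes "mean_zero_C1 f f'" "mean_zero_C1 g g'"
  shows "mean_zero_C1 (\<lambda>t. r * f t + s * g t) (\<lambda>t. r * f' t + s * g' t)"
proof -
  obtain F G where "\<forall>t\<in>I. (F has_real_derivative f t) (at t within I)" "F lo = F hi"
    "\<forall>t\<in>I. (G has_real_derivative g t) (at t within I)" "G lo = G hi"
    using assms unfolding mean_zero_C1_def by blast
  then have "\<exists>H. (\<forall>t\<in>I. (H has_real_derivative r * f t + s * g t) (at t within I)) \<and> H lo = H hi"
    by (intro exI[of _ "\<lambda>t. r * F t + s * G t"]) (auto intro!: DERIV_add DERIV_cmult)
  then show ?thesis
    using mean_zero_C1_D[OF assms(1)] mean_zero_C1_D[OF assms(2)] unfolding mean_zero_C1_def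
    by (auto intro!: DERIV_add DERIV_cmult continuous_intros)
qed

lemma mean_zero_C1_sum:
  assumes "\<And>m. mean_zero_C1 (G m) (G' m)"
  shows "mean_zero_C1 (\<lambda>t. \<Sum>m<(n::nat). G m t) (\<lambda>t. \<Sum>m<n. G' m t)"
proof (induction n)
  case 0
  then show ?case using mean_zero_C1_lin[OF assms assms, of 0 0 0 0] by simp
next
  case (Suc n)
  then show ?case using mean_zero_C1_lin[OF Suc assms, of 1 1 n] by simp
qed

text \<open>If \<open>F\<close> is an antiderivative of \<open>g\<close>, the sum of the
  \<open>F (d i t)\<close> is one of \<open>T g\<close>, and by \<open>telescope\<close> its
  endpoint difference is again \<open>F hi - F lo\<close>.\<close>

lemma mean_zero_C1_T:
  assumes "mean_zero_C1 g g'"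
  shows "mean_zero_C1 (T g) (D g g')"
proof -
  obtain F where F: "\<And>t. t \<in> I \<Longrightarrow> (F has_real_derivative g t) (at t within I)" "F lo = F hi"
    using assms unfolding mean_zero_C1_def by blast
  have "\<exists>H. (\<forall>t\<in>I. (H has_real_derivative T g t) (at t within I)) \<and> H lo = H hi"
    using sum_comp_d_deriv[OF F(1)] telescope[of F] F(2)
    by (intro exI[of _ "\<lambda>t. \<Sum>i\<in>J. F (d i t)"]) (simp add: sum_subtractf)
  then show ?thesis
    using mean_zero_C1_D[OF assms] T_deriv[of g g'] S_cont[of g'] B_cont[of g]
    unfolding mean_zero_C1_def D_def[abs_def] by (auto intro: continuous_on_add)
qed

text \<open>Compactness: a sequence of counterexamples with residuals tending to 0 has bounded
  derivatives, so a subsequence converges uniformly to a fixed point of \<open>T\<close>, a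
  constant. But every member has both a zero and a value of modulus 1.\<close>

lemma normalized_not_almost_fixed:
  "\<exists>\<epsilon>>0. \<forall>g g'. mean_zero_C1 g g' \<and> (\<forall>t\<in>I. \<bar>g t - T g t\<bar> \<le> \<epsilon>) \<and> (\<forall>t\<in>I. \<bar>g' t - D g g' t\<bar> \<le> \<epsilon>)
     \<and> (\<forall>t\<in>I. \<bar>g t\<bar> \<le> 1) \<longrightarrow> (\<forall>t\<in>I. \<bar>g t\<bar> \<noteq> 1)"
proof (rule ccontr)
  assume neg: "\<not> ?thesis"
  have "\<exists>g g'. mean_zero_C1 g g' \<and> (\<forall>t\<in>I. \<bar>g t - T g t\<bar> \<le> 1 / Suc n) \<and>
      (\<forall>t\<in>I. \<bar>g' t - D g g' t\<bar> \<le> 1 / Suc n) \<and> (\<forall>t\<in>I. \<bar>g t\<bar> \<le> 1) \<and> (\<exists>t\<in>I. \<bar>g t\<bar> = 1)" for n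
  proof -
    have "1 / real (Suc n) > 0" by simp
    then show ?thesis using neg by blast
  qed
  then obtain G G' where adm: "\<And>n. mean_zero_C1 (G n) (G' n)"
    and GT: "\<And>n t. t \<in> I \<Longrightarrow> \<bar>G n t - T (G n) t\<bar> \<le> 1 / Suc n"
    and GD: "\<And>n t. t \<in> I \<Longrightarrow> \<bar>G' n t - D (G n) (G' n) t\<bar> \<le> 1 / Suc n"
    and G1: "\<And>n t. t \<in> I \<Longrightarrow> \<bar>G n t\<bar> \<le> 1"
    and Gmax: "\<And>n. \<exists>t\<in>I. \<bar>G n t\<bar> = 1"
    by metis
  obtain b where b: "b \<ge> 0" "\<And>g M t. (\<forall>t\<in>I. \<bar>g t\<bar> \<le> M) \<Longrightarrow> t \<in> I \<Longrightarrow> \<bar>B g t\<bar> \<le> b * M"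
    using B_bound by blast
  obtain C where C: "C \<ge> 0" "\<And>w \<beta> t. continuous_on I w \<Longrightarrow> (\<forall>t\<in>I. \<bar>w t - S w t\<bar> \<le> \<beta>) \<Longrightarrow> t \<in> I \<Longrightarrow> \<bar>w t\<bar> \<le> C * \<beta>"
    using S_resolvent_bound by blast
  \<comment> \<open>The residual is at most 1 and the \<open>B\<close> term at most
    \<open>b\<close>, so \<open>C * (1 + b)\<close> bounds the derivatives; the extra 1 only makes
    \<open>K\<close> positive for the division by it.\<close>
  define K where "K = C * (1 + b) + 1"
  have G'K: "\<bar>G' n t\<bar> \<le> K" if t: "t \<in> I" for n t
  proof -
    have "\<bar>G' n x - S (G' n) x\<bar> \<le> 1 + b" if x: "x \<in> I" for x
    proof -
      have "\<bar>B (G n) x\<bar> \<le> b * 1" using G1 x by (intro b(2)) auto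
      moreover have "1 / real (Suc n) \<le> 1" by simp
      ultimately show ?thesis using GD[OF x, of n] unfolding D_def by linarith
    qed
    then show ?thesis using C(2)[OF mean_zero_C1_D(2)[OF adm], of n "1 + b" t] t by (simp add: K_def)
  qed
  have K: "K > 0" using C(1) b(1) by (simp add: K_def add_nonneg_pos)
  have lip: "\<bar>G n x - G n y\<bar> \<le> K * \<bar>x - y\<bar>" if "x \<in> I" "y \<in> I" for n x y
    using field_differentiable_bound[of I "G n" "G' n" K x y] mean_zero_C1_D(1)[OF adm] G'K that by auto
  have equi: "\<exists>\<delta>>0. \<forall>n y. y \<in> I \<and> norm (x - y) < \<delta> \<longrightarrow> norm (G n x - G n y) < e"
    if "x \<in> I" "0 < e" for x e
  proof (intro exI[of _ "e / K"] conjI allI impI)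
    fix n y assume "y \<in> I \<and> norm (x - y) < e / K"
    then show "norm (G n x - G n y) < e"
      using lip[OF that(1), of y n] K by (simp add: field_simps)
  qed (use K that in simp)
  obtain \<gamma> k where \<gamma>: "continuous_on I \<gamma>" "strict_mono (k :: nat \<Rightarrow> nat)"
    and conv: "\<And>e. 0 < e \<Longrightarrow> \<exists>N. \<forall>n x. n \<ge> N \<and> x \<in> I \<longrightarrow> norm (G (k n) x - \<gamma> x) < e"
    using Arzela_Ascoli[of I G 1] G1 equi by (metis compact_Icc real_norm_def)
  have lim: "(\<lambda>n. G (k n) x) \<longlonglongrightarrow> \<gamma> x" if "x \<in> I" for x
    unfolding LIMSEQ_iff using conv that by meson
  have "T \<gamma> t = \<gamma> t" if t: "t \<in> I" for t
  proof -
    have "(\<lambda>n. G (k n) t - T (G (k n)) t) \<longlonglongrightarrow> \<gamma> t - T \<gamma> t"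
      unfolding T_def by (intro tendsto_intros lim t d_in)
    moreover have "(\<lambda>n. G (k n) t - T (G (k n)) t) \<longlonglongrightarrow> 0"
    proof (rule Lim_null_comparison)
      show "(\<lambda>n. 1 / real (Suc (k n))) \<longlonglongrightarrow> 0"
        using LIMSEQ_subseq_LIMSEQ[OF LIMSEQ_Suc[OF lim_1_over_n] \<gamma>(2)] by (simp add: o_def)
      show "\<forall>\<^sub>F n in sequentially. norm (G (k n) t - T (G (k n)) t) \<le> 1 / real (Suc (k n))"
        unfolding real_norm_def by (intro always_eventually allI GT t)
    qed
    ultimately show ?thesis using LIMSEQ_unique by fastforce
  qed
  then have const: "\<gamma> x = \<gamma> t0" if "x \<in> I" for x
    by (rule fixed_const[OF \<gamma>(1) _ that])
  obtain n where n: "\<And>x. x \<in> I \<Longrightarrow> \<bar>G (k n) x - \<gamma> t0\<bar> < 1/2"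
    using conv[of "1/2"] const by auto
  \<comment> \<open>The zero gives \<open>\<bar>\<gamma> t0\<bar> < 1/2\<close>, the point of
    modulus 1 gives \<open>\<bar>\<gamma> t0\<bar> > 1/2\<close>.\<close>
  obtain z x where zx: "z \<in> I" "G (k n) z = 0" "x \<in> I" "\<bar>G (k n) x\<bar> = 1"
    using mean_zero_C1_zero[OF adm] Gmax by metis
  then show False using n[OF zx(1)] n[OF zx(3)] by linarith
qed

text \<open>By scaling: if the maximum of \<open>\<bar>g\<bar>\<close> exceeded
  \<open>\<beta> / \<epsilon>\<close>, dividing by it would give a normalized function with
  residuals at most \<open>\<epsilon>\<close>. The bound on \<open>g'\<close> then follows from that
  on \<open>g\<close>.\<close>

lemma a_priori_bound:
  "\<exists>C\<ge>0. \<forall>g g' \<beta>. mean_zero_C1 g g' \<and> (\<forall>t\<in>I. \<bar>g t - T g t\<bar> \<le> \<beta> \<and> \<bar>g' t - D g g' t\<bar> \<le> \<beta>) \<longrightarrow>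
     (\<forall>t\<in>I. \<bar>g t\<bar> \<le> C * \<beta> \<and> \<bar>g' t\<bar> \<le> C * \<beta>)"
proof -
  obtain \<epsilon> where \<epsilon>: "\<epsilon> > 0" and nf: "\<And>g g' t. mean_zero_C1 g g' \<Longrightarrow> (\<forall>t\<in>I. \<bar>g t - T g t\<bar> \<le> \<epsilon>) \<Longrightarrow>
      (\<forall>t\<in>I. \<bar>g' t - D g g' t\<bar> \<le> \<epsilon>) \<Longrightarrow> (\<forall>t\<in>I. \<bar>g t\<bar> \<le> 1) \<Longrightarrow> t \<in> I \<Longrightarrow> \<bar>g t\<bar> \<noteq> 1"
    using normalized_not_almost_fixed by blast
  obtain b where b: "b \<ge> 0" "\<And>g M t. (\<forall>t\<in>I. \<bar>g t\<bar> \<le> M) \<Longrightarrow> t \<in> I \<Longrightarrow> \<bar>B g t\<bar> \<le> b * M"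
    using B_bound by blast
  obtain C where C: "C \<ge> 0" "\<And>w \<beta> t. continuous_on I w \<Longrightarrow> (\<forall>t\<in>I. \<bar>w t - S w t\<bar> \<le> \<beta>) \<Longrightarrow> t \<in> I \<Longrightarrow> \<bar>w t\<bar> \<le> C * \<beta>"
    using S_resolvent_bound by blast
  \<comment> \<open>The first summand serves \<open>g\<close>, the second \<open>g'\<close>.\<close>
  define C' where "C' = 1 / \<epsilon> + C * (1 + b / \<epsilon>)"
  have "\<bar>g t\<bar> \<le> C' * \<beta> \<and> \<bar>g' t\<bar> \<le> C' * \<beta>"
    if adm: "mean_zero_C1 g g'" and gT: "\<And>t. t \<in> I \<Longrightarrow> \<bar>g t - T g t\<bar> \<le> \<beta>"
      and gD: "\<And>t. t \<in> I \<Longrightarrow> \<bar>g' t - D g g' t\<bar> \<le> \<beta>" and t: "t \<in> I" for g g' \<beta> t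
  proof -
    have \<beta>: "\<beta> \<ge> 0" using gT[OF t] by linarith
    obtain m where m: "m \<in> I" "\<And>x. x \<in> I \<Longrightarrow> \<bar>g x\<bar> \<le> \<bar>g m\<bar>"
      using continuous_attains_sup[OF _ _ continuous_on_rabs[OF mean_zero_C1_D(3)[OF adm]]] lo_less_hi
      by auto
    have gm: "\<bar>g m\<bar> \<le> \<beta> / \<epsilon>"
    proof (rule ccontr)
      assume "\<not> ?thesis"
      then have M: "\<beta> < \<epsilon> * \<bar>g m\<bar>" "\<bar>g m\<bar> > 0"
        using \<epsilon> \<beta> by (auto simp: field_simps intro: le_less_trans[OF divide_nonneg_pos])
      define s where "s = 1 / \<bar>g m\<bar>"
      have s: "s > 0" "s * \<beta> \<le> \<epsilon>" "s * \<bar>g m\<bar> = 1" using M by (auto simp: s_def field_simps)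
      have "\<bar>s * g m\<bar> \<noteq> 1"
      proof (rule nf[of "\<lambda>t. s * g t" "\<lambda>t. s * g' t"])
        show "mean_zero_C1 (\<lambda>t. s * g t) (\<lambda>t. s * g' t)"
          using mean_zero_C1_lin[OF adm adm, of s 0] by simp
        have le: "\<bar>s * x\<bar> \<le> \<epsilon>" if "\<bar>x\<bar> \<le> \<beta>" for x
        proof -
          have "s * \<bar>x\<bar> \<le> \<epsilon>" using mult_left_mono[OF that, of s] s by linarith
          then show ?thesis using s by (simp add: abs_mult)
        qed
        show "\<forall>t\<in>I. \<bar>s * g t - T (\<lambda>t. s * g t) t\<bar> \<le> \<epsilon>"
          using T_lin[of s g 0 g] le[OF gT] by (auto simp: right_diff_distrib)
        show "\<forall>t\<in>I. \<bar>s * g' t - D (\<lambda>t. s * g t) (\<lambda>t. s * g' t) t\<bar> \<le> \<epsilon>"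
          using D_lin[of s g 0 g g' g'] le[OF gD] by (auto simp: right_diff_distrib)
        show "\<forall>t\<in>I. \<bar>s * g t\<bar> \<le> 1"
          using mult_left_mono[OF m(2), of _ s] s by (auto simp: abs_mult)
      qed (fact m(1))
      then show False using s by (simp add: abs_mult)
    qed
    then have g_le: "\<bar>g x\<bar> \<le> \<beta> / \<epsilon>" if "x \<in> I" for x using m(2)[OF that] by linarith
    \<comment> \<open>Moving the \<open>B\<close> part of \<open>D\<close> into the error leaves an
      equation for \<open>S\<close> alone.\<close>
    have "\<bar>g' x - S g' x\<bar> \<le> \<beta> + b * (\<beta> / \<epsilon>)" if "x \<in> I" for x
      using gD[OF that] b(2)[of g "\<beta> / \<epsilon>" x] g_le that unfolding D_def by fastforce
    then have "\<bar>g' t\<bar> \<le> C * (\<beta> + b * (\<beta> / \<epsilon>))"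
      using C(2)[OF mean_zero_C1_D(2)[OF adm]] t by blast
    moreover have "0 \<le> C * (\<beta> + b * (\<beta> / \<epsilon>))" "0 \<le> \<beta> / \<epsilon>" using C b \<beta> \<epsilon> by auto
    moreover have "C' * \<beta> = \<beta> / \<epsilon> + C * (\<beta> + b * (\<beta> / \<epsilon>))" by (simp add: C'_def algebra_simps)
    ultimately show ?thesis using g_le[OF t] by linarith
  qed
  moreover have "C' \<ge> 0" using C b \<epsilon> by (simp add: C'_def)
  ultimately show ?thesis by blast
qed

subsection \<open>Solvability by averaging\<close>

text \<open>The derivatives of the iterates of \<open>T\<close> on \<open>k\<close>; each step also
  uses the iterate itself, because \<open>D\<close> contains \<open>B\<close>.\<close>

fun iter' :: "(real \<Rightarrow> real) \<Rightarrow> (real \<Rightarrow> real) \<Rightarrow> nat \<Rightarrow> real \<Rightarrow> real" where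
  "iter' k k' 0 = k'"
| "iter' k k' (Suc n) = D ((T ^^ n) k) (iter' k k' n)"

lemma mean_zero_C1_iter:
  "mean_zero_C1 k k' \<Longrightarrow> mean_zero_C1 ((T ^^ n) k) (iter' k k' n)"
  by (induction n) (auto intro: mean_zero_C1_T)

text \<open>The iterates stay below the bound of \<open>k\<close> because \<open>T\<close> does not
  increase the sup norm. Their derivatives obey a recursion with contracting part \<open>S\<close>
  and bounded forcing \<open>B\<close>.\<close>

lemma power_bounded:
  assumes "mean_zero_C1 k k'"
  shows "\<exists>K\<ge>0. \<forall>n. \<forall>t\<in>I. \<bar>(T ^^ n) k t\<bar> \<le> K \<and> \<bar>iter' k k' n t\<bar> \<le> K"
proof -
  have "bounded (k ` I)" "bounded (k' ` I)"
    using mean_zero_C1_D[OF assms] compact_continuous_image compact_imp_bounded by blast+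
  then obtain K K' where K: "\<And>t. t \<in> I \<Longrightarrow> \<bar>k t\<bar> \<le> K" and K': "\<And>t. t \<in> I \<Longrightarrow> \<bar>k' t\<bar> \<le> K'"
    unfolding bounded_iff by (metis imageI real_norm_def)
  have K0: "K \<ge> 0" "K' \<ge> 0" using K[of lo] K'[of lo] lo_less_hi by force+
  have Tn: "\<bar>(T ^^ n) k t\<bar> \<le> K" if "t \<in> I" for n t
    using that by (induction n arbitrary: t) (auto intro: K abs_T_le)
  obtain b where b: "b \<ge> 0" "\<And>g M t. (\<forall>t\<in>I. \<bar>g t\<bar> \<le> M) \<Longrightarrow> t \<in> I \<Longrightarrow> \<bar>B g t\<bar> \<le> b * M"
    using B_bound by blast
  obtain \<phi> r C where \<phi>: "continuous_on I \<phi>" "\<And>t. t \<in> I \<Longrightarrow> 1 \<le> \<phi> t" "\<And>t. t \<in> I \<Longrightarrow> \<phi> t \<le> C"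
    and r: "0 \<le> r" "r < 1" "\<And>t. t \<in> I \<Longrightarrow> S \<phi> t \<le> r * \<phi> t"
    using S_contraction_weight by blast
  \<comment> \<open>Chosen so that \<open>M * r + b * K \<le> M\<close> and
    \<open>M \<ge> K'\<close>: the weighted ball of radius \<open>M\<close> contains the initial
    derivative and is preserved by the recursion.\<close>
  define M where "M = K' + b * K / (1 - r)"
  have M0: "M \<ge> K'" "M \<ge> 0" using K0 b r by (auto simp: M_def)
  have "M * r + b * K \<le> M"
  proof -
    have "M * (1 - r) = K' * (1 - r) + b * K" using r by (simp add: M_def field_simps)
    moreover have "K' * (1 - r) \<ge> 0" using K0 r by simp
    ultimately show ?thesis by (simp add: algebra_simps)
  qed
  have Mn: "\<bar>iter' k k' n t\<bar> \<le> M * \<phi> t" if "t \<in> I" for n t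
    using that
  proof (induction n arbitrary: t)
    case 0
    have "M * 1 \<le> M * \<phi> t" using \<phi>(2)[OF 0] M0 by (intro mult_left_mono) auto
    then show ?case using K'[OF 0] M0 by simp
  next
    case (Suc n)
    have "\<bar>S (iter' k k' n) t\<bar> \<le> M * (r * \<phi> t)"
      using abs_S_le[of "iter' k k' n" M \<phi> t] Suc mult_left_mono[OF r(3)[OF Suc.prems] M0(2)] by fastforce
    moreover have "\<bar>B ((T ^^ n) k) t\<bar> \<le> b * K" using Tn Suc.prems by (intro b(2)) auto
    moreover have "b * K * 1 \<le> b * K * \<phi> t"
      using \<phi>(2)[OF Suc.prems] b K0 by (intro mult_left_mono) auto
    moreover have "(M * r + b * K) * \<phi> t \<le> M * \<phi> t"
      using \<phi>(2)[OF Suc.prems] \<open>M * r + b * K \<le> M\<close> by (intro mult_right_mono) auto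
    ultimately show ?case by (simp add: D_def algebra_simps)
  qed
  have "\<bar>(T ^^ n) k t\<bar> \<le> K + M * C \<and> \<bar>iter' k k' n t\<bar> \<le> K + M * C" if "t \<in> I" for n t
  proof -
    have "M * \<phi> t \<le> M * C" "0 \<le> M * \<phi> t"
      using \<phi>(2,3)[OF that] M0 by (auto intro: mult_left_mono)
    then show ?thesis using Mn[OF that, of n] Tn[OF that, of n] K0 by linarith
  qed
  moreover have "0 \<le> K + M * C" using K0 M0 \<phi>(2,3)[of lo] lo_less_hi by (intro add_nonneg_nonneg mult_nonneg_nonneg) force+
  ultimately show ?thesis by blast
qed

lemma uniformly_Cauchy_harmonic:
  fixes f :: "nat \<Rightarrow> real \<Rightarrow> real"
  assumes "\<And>m n t. t \<in> X \<Longrightarrow> \<bar>f m t - f n t\<bar> \<le> A * (1 / Suc m + 1 / Suc n)" "A \<ge> 0"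
  shows "uniformly_Cauchy_on X f"
proof (rule uniformly_Cauchy_onI)
  fix e :: real assume "e > 0"
  \<comment> \<open>The summand 1 keeps the denominator positive when \<open>A = 0\<close>.\<close>
  then obtain N where N: "1 / real (Suc N) < e / (2 * A + 1)"
    using assms(2) by (metis add_nonneg_pos divide_pos_pos inverse_eq_divide mult_nonneg_nonneg reals_Archimedean zero_le_numeral zero_less_one)
  have "dist (f m t) (f n t) < e" if "t \<in> X" "m \<ge> N" "n \<ge> N" for t m n
  proof -
    have "1 / real (Suc m) \<le> 1 / Suc N" "1 / real (Suc n) \<le> 1 / Suc N"
      using that by (auto intro!: divide_left_mono)
    then have "A * (1 / Suc m + 1 / Suc n) \<le> A * (2 * (1 / Suc N))"
      using assms(2) by (intro mult_left_mono) auto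
    then have "dist (f m t) (f n t) \<le> 2 * A * (1 / Suc N)"
      using assms(1)[OF that(1), of m n] by (simp add: dist_real_def mult.commute)
    moreover have "(2 * A + 1) * (1 / Suc N) < e" using N assms(2) by (simp add: field_simps)
    moreover have "1 / real (Suc N) > 0" by simp
    ultimately show ?thesis unfolding distrib_right by linarith
  qed
  then show "\<exists>M. \<forall>t\<in>X. \<forall>m\<ge>M. \<forall>n\<ge>M. dist (f m t) (f n t) < e" by blast
qed

text \<open>The partial sums \<open>s n\<close> leave the residual \<open>x n\<close>, which is only
  known to be bounded; but the a priori bound then makes \<open>s n\<close> bounded. Summing again,
  the averages \<open>u n\<close> leave a residual of order \<open>1/n\<close>, and the same bound
  for their differences makes them Cauchy together with their derivatives.\<close>

lemma solve_mean_zero: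
  assumes k: "mean_zero_C1 k k'"
  obtains g g' where "\<And>t. t \<in> I \<Longrightarrow> (g has_real_derivative g' t) (at t within I)"
    "continuous_on I g'" "\<And>t. t \<in> I \<Longrightarrow> g t - T g t = k t"
proof -
  define x x' where "x n = (T ^^ n) k" and "x' n = iter' k k' n" for n
  define s s' where "s n t = (\<Sum>m<n. x m t)" and "s' n t = (\<Sum>m<n. x' m t)" for n t
  define v v' where "v n t = (\<Sum>m<n. s m t)" and "v' n t = (\<Sum>m<n. s' m t)" for n t
  obtain K where K: "K \<ge> 0" "\<And>n t. t \<in> I \<Longrightarrow> \<bar>x n t\<bar> \<le> K \<and> \<bar>x' n t\<bar> \<le> K"
    using power_bounded[OF k] unfolding x_def x'_def by blast
  obtain C where C: "C \<ge> 0" "\<And>g g' \<beta> t. mean_zero_C1 g g' \<Longrightarrow>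
      (\<forall>t\<in>I. \<bar>g t - T g t\<bar> \<le> \<beta> \<and> \<bar>g' t - D g g' t\<bar> \<le> \<beta>) \<Longrightarrow> t \<in> I \<Longrightarrow> \<bar>g t\<bar> \<le> C * \<beta> \<and> \<bar>g' t\<bar> \<le> C * \<beta>"
    using a_priori_bound by blast
  have x: "mean_zero_C1 (x n) (x' n)" for n
    unfolding x_def x'_def by (rule mean_zero_C1_iter[OF k])
  have s: "mean_zero_C1 (s n) (s' n)" for n
    unfolding s_def[abs_def] s'_def[abs_def] by (rule mean_zero_C1_sum[OF x])
  have v: "mean_zero_C1 (v n) (v' n)" for n
    unfolding v_def[abs_def] v'_def[abs_def] by (rule mean_zero_C1_sum[OF s])
  have xS: "T (x n) = x (Suc n)" "D (x n) (x' n) = x' (Suc n)" for n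
    by (simp_all add: x_def x'_def)
  have sT: "s n t - T (s n) t = k t - x n t" and sD: "s' n t - D (s n) (s' n) t = k' t - x' n t" for n t
    using sum_lessThan_telescope'[of "\<lambda>n. x n t" n] sum_lessThan_telescope'[of "\<lambda>n. x' n t" n]
    by (simp_all add: s_def[abs_def] s'_def[abs_def] T_sum D_sum xS sum_subtractf) (simp_all add: x_def x'_def)
  have vT: "v n t - T (v n) t = n * k t - s n t" and vD: "v' n t - D (v n) (v' n) t = n * k' t - s' n t" for n t
  proof -
    have "(\<Sum>m<n. s m t - T (s m) t) = (\<Sum>m<n. k t - x m t)"
      "(\<Sum>m<n. s' m t - D (s m) (s' m) t) = (\<Sum>m<n. k' t - x' m t)"
      by (simp_all only: sT sD)
    then show "v n t - T (v n) t = n * k t - s n t" "v' n t - D (v n) (v' n) t = n * k' t - s' n t"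
      unfolding v_def[abs_def] v'_def[abs_def] T_sum D_sum
      by (simp_all add: sum_subtractf) (simp_all add: s_def s'_def)
  qed
  have s_le: "\<bar>s n t\<bar> \<le> C * (2 * K) \<and> \<bar>s' n t\<bar> \<le> C * (2 * K)" if "t \<in> I" for n t
  proof (rule C(2)[OF s _ that], intro ballI)
    fix y assume y: "y \<in> I"
    have "x 0 y = k y" "x' 0 y = k' y" by (simp_all add: x_def x'_def)
    then show "\<bar>s n y - T (s n) y\<bar> \<le> 2 * K \<and> \<bar>s' n y - D (s n) (s' n) y\<bar> \<le> 2 * K"
      unfolding sT sD using K(2)[OF y, of n] K(2)[OF y, of 0] by linarith
  qed
  define L where "L = C * (2 * K)"
  have L: "L \<ge> 0" using C K by (simp add: L_def)
  \<comment> \<open>The index is shifted by one, so that \<open>u n\<close> averages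
    \<open>Suc n\<close> terms and the division is always by a positive number.\<close>
  define c :: "nat \<Rightarrow> real" where "c n = 1 / Suc n" for n
  have c: "c n > 0" "c n * Suc n = 1" for n by (auto simp: c_def)
  define u u' where "u n t = c n * v (Suc n) t" and "u' n t = c n * v' (Suc n) t" for n t
  have uT: "u n t - T (u n) t = k t - c n * s (Suc n) t"
    and uD: "u' n t - D (u n) (u' n) t = k' t - c n * s' (Suc n) t" for n t
  proof -
    have "T (u n) t = c n * T (v (Suc n)) t" "D (u n) (u' n) t = c n * D (v (Suc n)) (v' (Suc n)) t"
      using T_lin[of "c n" "v (Suc n)" 0 k t] D_lin[of "c n" "v (Suc n)" 0 k "v' (Suc n)" k' t]
      by (simp_all add: u_def[abs_def] u'_def[abs_def])
    then have "u n t - T (u n) t = c n * (v (Suc n) t - T (v (Suc n)) t)"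
       "u' n t - D (u n) (u' n) t = c n * (v' (Suc n) t - D (v (Suc n)) (v' (Suc n)) t)"
      by (simp_all add: u_def u'_def right_diff_distrib)
    then show "u n t - T (u n) t = k t - c n * s (Suc n) t"
      "u' n t - D (u n) (u' n) t = k' t - c n * s' (Suc n) t"
      unfolding vT vD using c(2)[of n] by (simp_all only: right_diff_distrib mult.assoc[symmetric] mult_1)
  qed
  have u: "mean_zero_C1 (u n) (u' n)" for n
    using mean_zero_C1_lin[OF v v, of "c n" "Suc n" 0 0] by (simp add: u_def[abs_def] u'_def[abs_def])
  have diff: "\<bar>u m t - u n t\<bar> \<le> C * L * (c m + c n) \<and> \<bar>u' m t - u' n t\<bar> \<le> C * L * (c m + c n)"
    if t: "t \<in> I" for m n t
  proof -
    \<comment> \<open>The coefficients 1 and -1 are written out so that \<open>T_lin\<close> and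
      \<open>D_lin\<close> apply; in the residual of the difference \<open>k\<close>
      cancels.\<close>
    have mz: "mean_zero_C1 (\<lambda>t. 1 * u m t + (-1) * u n t) (\<lambda>t. 1 * u' m t + (-1) * u' n t)"
      by (rule mean_zero_C1_lin[OF u u])
    have "\<bar>1 * u m t + (-1) * u n t\<bar> \<le> C * (L * (c m + c n)) \<and> \<bar>1 * u' m t + (-1) * u' n t\<bar> \<le> C * (L * (c m + c n))"
    proof (rule C(2)[OF mz _ t], intro ballI)
      fix y assume y: "y \<in> I"
      have cs: "\<bar>c n * s (Suc n) y\<bar> \<le> L * c n" "\<bar>c n * s' (Suc n) y\<bar> \<le> L * c n" for n
        using s_le[OF y, of "Suc n"] c(1)[of n] by (auto simp: abs_mult L_def mult.commute)
      show "\<bar>1 * u m y + (-1) * u n y - T (\<lambda>t. 1 * u m t + (-1) * u n t) y\<bar> \<le> L * (c m + c n) \<and>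
        \<bar>1 * u' m y + (-1) * u' n y - D (\<lambda>t. 1 * u m t + (-1) * u n t) (\<lambda>t. 1 * u' m t + (-1) * u' n t) y\<bar>
          \<le> L * (c m + c n)"
        unfolding T_lin D_lin distrib_left
        using uT[of m y] uT[of n y] uD[of m y] uD[of n y] cs[of m] cs[of n] by linarith
    qed
    then show ?thesis by simp
  qed
  have "uniformly_convergent_on I u" "uniformly_convergent_on I u'"
    using diff C(1) L
    by (auto intro!: Cauchy_uniformly_convergent uniformly_Cauchy_harmonic[of _ _ "C * L"] simp: c_def)
  then obtain l l' where l: "uniform_limit I u l sequentially" and l': "uniform_limit I u' l' sequentially"
    unfolding uniformly_convergent_on_def by blast
  have lim: "(\<lambda>n. u n t) \<longlonglongrightarrow> l t" if "t \<in> I" for t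
    using tendsto_uniform_limitI[OF l that] .
  show ?thesis
  proof (rule that[of l l'])
    show "continuous_on I l'"
      by (rule uniform_limit_theorem[OF _ l']) (use mean_zero_C1_D(2)[OF u] in auto)
    \<comment> \<open>Uniform convergence of the derivatives makes the limit differentiable; the
      limit function obtained here agrees with \<open>l\<close> on the interval only, hence the
      transfer below.\<close>
    have "\<exists>g. \<forall>t\<in>I. (\<lambda>n. u n t) \<longlonglongrightarrow> g t \<and> (g has_derivative (\<lambda>y. l' t * y)) (at t within I)"
    proof (rule has_derivative_sequence)
      show "(u n has_derivative (\<lambda>y. u' n t * y)) (at t within I)" if "t \<in> I" for n t
        using mean_zero_C1_D(1)[OF u that] by (simp add: has_field_derivative_def)
      fix e :: real assume "e > 0"
      have "norm (u' n x * y - l' x * y) \<le> e * norm y" if "dist (u' n x) (l' x) < e" for n x y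
        using mult_right_mono[OF less_imp_le[OF that], of "norm y"]
        by (simp add: dist_real_def abs_mult left_diff_distrib[symmetric])
      then show "\<forall>\<^sub>F n in sequentially. \<forall>x\<in>I. \<forall>h. norm (u' n x * h - l' x * h) \<le> e * norm h"
        using uniform_limitD[OF l' \<open>e > 0\<close>] by (auto elim!: eventually_mono)
    qed (use lim[of lo] lo_less_hi in auto)
    then obtain g where g: "\<And>t. t \<in> I \<Longrightarrow> (\<lambda>n. u n t) \<longlonglongrightarrow> g t"
      "\<And>t. t \<in> I \<Longrightarrow> (g has_real_derivative l' t) (at t within I)"
      unfolding has_field_derivative_def by blast
    have gl: "g t = l t" if "t \<in> I" for t using LIMSEQ_unique[OF g(1) lim] that by blast
    show "(l has_real_derivative l' t) (at t within I)" if "t \<in> I" for t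
      by (rule has_field_derivative_transform_within[OF g(2)[OF that] zero_less_one that]) (simp add: gl)
    fix t assume t: "t \<in> I"
    have "(\<lambda>n. u n t - T (u n) t) \<longlonglongrightarrow> l t - T l t"
      unfolding T_def by (intro tendsto_intros lim t d_in)
    moreover have "(\<lambda>n. u n t - T (u n) t) \<longlonglongrightarrow> k t - 0"
      unfolding uT
    proof (intro tendsto_diff tendsto_const, rule Lim_null_comparison)
      show "(\<lambda>n. c n * L) \<longlonglongrightarrow> 0"
        using tendsto_mult_left_zero[OF LIMSEQ_Suc[OF lim_1_over_n], of L] by (simp add: c_def)
      show "\<forall>\<^sub>F n in sequentially. norm (c n * s (Suc n) t) \<le> c n * L"
        using s_le[OF t] c(1) by (auto simp: abs_mult L_def less_imp_le intro!: always_eventually mult_left_mono)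
    qed
    ultimately show "l t - T l t = k t" using LIMSEQ_unique by fastforce
  qed
qed

subsection \<open>The functional equation\<close>

text \<open>Solve the differentiated equation and integrate. Two free constants remain: one added to
  \<open>g\<close> adjusts the derivative at \<open>c\<close>, one added to the antiderivative
  removes the constant of integration.\<close>

lemma functional_equation_exists:
  assumes h': "\<And>t. t \<in> I \<Longrightarrow> (h has_real_derivative h' t) (at t within I)"
    and h'': "\<And>t. t \<in> I \<Longrightarrow> (h' has_real_derivative h'' t) (at t within I)"
    and h''_cont: "continuous_on I h''" and h_eq: "h lo = h hi"
  obtains f f' f'' where "\<And>t. t \<in> I \<Longrightarrow> (f has_real_derivative f' t) (at t within I)"
    "\<And>t. t \<in> I \<Longrightarrow> (f' has_real_derivative f'' t) (at t within I)"
    "continuous_on I f''" "\<And>t. t \<in> I \<Longrightarrow> f t - (\<Sum>i\<in>J. f (d i t)) = h t" "f' c = \<mu>"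
proof -
  have "mean_zero_C1 h' h''"
    unfolding mean_zero_C1_def using assms by blast
  then obtain g g' where g': "\<And>t. t \<in> I \<Longrightarrow> (g has_real_derivative g' t) (at t within I)"
    and g'_cont: "continuous_on I g'" and g: "\<And>t. t \<in> I \<Longrightarrow> g t - T g t = h' t"
    using solve_mean_zero by blast
  define f' where "f' t = g t + (\<mu> - g c)" for t
  have f'_deriv: "(f' has_real_derivative g' t) (at t within I)" if "t \<in> I" for t
    unfolding f'_def[abs_def] using DERIV_add[OF g'[OF that] DERIV_const] by simp
  have "continuous_on I f'" using f'_deriv by (metis DERIV_continuous_on)
  define F where "F t = integral {lo..t} f'" for t
  have F: "(F has_real_derivative f' t) (at t within I)" if "t \<in> I" for t
    unfolding F_def[abs_def] by (rule integral_has_real_derivative[OF \<open>continuous_on I f'\<close> that])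
  have "\<exists>\<kappa>. \<forall>t\<in>I. F t - (\<Sum>i\<in>J. F (d i t)) - h t = \<kappa>"
  proof (rule has_field_derivative_zero_constant)
    fix t assume t: "t \<in> I"
    have "T f' t = T g t + (\<mu> - g c)"
      using T_lin[of 1 g 1 "\<lambda>_. \<mu> - g c" t] T_const[OF t, of "\<mu> - g c"] by (simp add: f'_def[abs_def])
    then have "f' t - T f' t - h' t = 0" using g[OF t] by (simp add: f'_def)
    then show "((\<lambda>t. F t - (\<Sum>i\<in>J. F (d i t)) - h t) has_real_derivative 0) (at t within I)"
      using DERIV_diff[OF DERIV_diff[OF F[OF t] sum_comp_d_deriv[OF F t]] h'[OF t]] by simp
  qed simp
  then obtain \<kappa> where \<kappa>: "\<And>t. t \<in> I \<Longrightarrow> F t - (\<Sum>i\<in>J. F (d i t)) - h t = \<kappa>" by blast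
  \<comment> \<open>Adding \<open>w\<close> to \<open>F\<close> changes the left side by
    \<open>(1 - card J) * w\<close>, which must cancel \<open>\<kappa>\<close>; this is solvable
    because \<open>card J \<ge> 2\<close>.\<close>
  define w where "w = \<kappa> / (real (card J) - 1)"
  have w: "\<kappa> = (real (card J) - 1) * w"
    using card_J by (simp add: w_def)
  define f where "f t = F t + w" for t
  show ?thesis
  proof (rule that[of f f' g'])
    show "(f has_real_derivative f' t) (at t within I)" if "t \<in> I" for t
      unfolding f_def[abs_def] using DERIV_add[OF F[OF that] DERIV_const] by simp
    show "f t - (\<Sum>i\<in>J. f (d i t)) = h t" if "t \<in> I" for t
      using \<kappa>[OF that] unfolding w by (simp add: f_def sum.distrib algebra_simps)
  qed (use f'_deriv g'_cont in \<open>auto simp: f'_def\<close>)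
qed

text \<open>Differentiation makes \<open>f'\<close> a fixed point of \<open>T\<close>, hence
  constant and, by its value at \<open>c\<close>, zero. So \<open>f\<close> is a constant, and the
  equation multiplies it by \<open>1 - card J\<close>, which is not 0.\<close>

lemma functional_equation_homogeneous:
  assumes f': "\<And>t. t \<in> I \<Longrightarrow> (f has_real_derivative f' t) (at t within I)" "continuous_on I f'"
    and eq: "\<And>t. t \<in> I \<Longrightarrow> f t - (\<Sum>i\<in>J. f (d i t)) = 0"
    and c: "c \<in> I" "f' c = 0" and t: "t \<in> I"
  shows "f t = 0"
proof -
  have "T f' x = f' x" if x: "x \<in> I" for x
  proof -
    have "((\<lambda>t. f t - (\<Sum>i\<in>J. f (d i t))) has_real_derivative f' x - T f' x) (at x within I)"
      by (rule DERIV_diff[OF f'(1)[OF x] sum_comp_d_deriv[OF f'(1) x]])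
    moreover have "((\<lambda>t. f t - (\<Sum>i\<in>J. f (d i t))) has_real_derivative 0) (at x within I)"
      by (rule has_field_derivative_transform_within[OF DERIV_const[of 0] zero_less_one x]) (use eq in simp)
    ultimately have "f' x - T f' x = 0"
      using vector_derivative_unique_within_closed_interval[of lo hi x] lo_less_hi x
      unfolding has_real_derivative_iff_has_vector_derivative by (metis cbox_interval)
    then show ?thesis by simp
  qed
  then have "f' x = 0" if "x \<in> I" for x
    using fixed_const[OF f'(2)] c that by metis
  then obtain \<kappa> where \<kappa>: "\<And>x. x \<in> I \<Longrightarrow> f x = \<kappa>"
    using has_field_derivative_zero_constant[of I f] f'(1) by (metis convex_real_interval(5))
  then have "(\<Sum>i\<in>J. f (d i t)) = (\<Sum>i\<in>J. \<kappa>)" by (intro sum.cong refl) (use d_in t in blast)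
  then have "\<kappa> * (real (card J) - 1) = 0" using eq[OF t] \<kappa>[OF t] by (simp add: algebra_simps)
  then show ?thesis using card_J \<kappa>[OF t] by auto
qed

end

section \<open>From orbits and guiding sets to the abstract setting\<close>

lemma proper_orbit_in_invariant:
  assumes "proper_orbit I N \<delta> \<Lambda> ts" "hd ts \<in> Z"
    and inv: "\<And>t i. t \<in> Z \<Longrightarrow> i \<in> {1..N} \<Longrightarrow> t \<notin> \<Lambda> i \<Longrightarrow> \<delta> i t \<in> Z"
  shows "last ts \<in> Z"
proof -
  have ts: "ts \<noteq> []" using assms(1) by (simp add: proper_orbit_def)
  have "ts ! j \<in> Z" if "j < length ts" for j
    using that
  proof (induction j)
    case 0
    then show ?case using assms(2) ts by (simp add: hd_conv_nth)
  next
    case (Suc j)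
    then obtain i where "i \<in> {1..N}" "ts ! j \<notin> \<Lambda> i" "ts ! Suc j = \<delta> i (ts ! j)"
      using assms(1) unfolding proper_orbit_def by blast
    then show ?case using inv Suc by simp
  qed
  then show ?thesis using ts by (simp add: last_conv_nth)
qed

text \<open>Orbits from a point of \<open>Z\<close> stay in \<open>Z\<close>, so the closure of its
  orbit set, which contains \<open>t0\<close>, lies in \<open>Z\<close>.\<close>

lemma weak_attractor_in_closed_invariant:
  assumes "weak_attractor I N \<delta> \<Lambda> t0" "closed Z" "Z \<subseteq> I" "Z \<noteq> {}"
    and "\<And>t i. t \<in> Z \<Longrightarrow> i \<in> {1..N} \<Longrightarrow> t \<notin> \<Lambda> i \<Longrightarrow> \<delta> i t \<in> Z"
  shows "t0 \<in> Z"
proof -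
  obtain z where z: "z \<in> Z" using assms(4) by blast
  have "orbit_set I N \<delta> \<Lambda> z \<subseteq> Z"
  proof
    fix s assume "s \<in> orbit_set I N \<delta> \<Lambda> z"
    then obtain ts where ts: "proper_orbit I N \<delta> \<Lambda> ts" "hd ts = z" "last ts = s"
      unfolding orbit_set_def by blast
    then show "s \<in> Z"
      using proper_orbit_in_invariant[of I N \<delta> \<Lambda> ts Z] assms(5) z by blast
  qed
  then have "closure (orbit_set I N \<delta> \<Lambda> z) \<subseteq> Z"
    using assms(2) by (rule closure_minimal)
  then show ?thesis using assms(1,3) z unfolding weak_attractor_def by blast
qed

lemma deriv_within_eq:
  assumes "lo < hi" "t \<in> {lo..hi}" "(f has_real_derivative D) (at t within {lo..hi})"
  shows "deriv_within f {lo..hi} t = D"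
  using vector_derivative_within_closed_interval[OF assms(1,2)] assms(3)
  by (simp add: has_real_derivative_iff_has_vector_derivative)

text \<open>The witnesses are the derivatives supplied by \<open>C2_on\<close>. Uniqueness of
  derivatives within the interval makes each guiding set the zero set of \<open>p i\<close>, so
  proper steps are those of positive weight, and every weight is positive at
  \<open>t0\<close>.\<close>

lemma P_configuration_branching_config:
  assumes P: "P_configuration N a \<delta>"
    and t0: "t0 \<in> {a 0..a N} - (\<Union>i\<in>{1..N}. guiding_set {a 0..a N} \<delta> i)"
    and w: "weak_attractor {a 0..a N} N \<delta> (guiding_set {a 0..a N} \<delta>) t0"
  shows "\<exists>p q. branching_config (a 0) (a N) {1..N} \<delta> p q t0"
proof -
  have N: "1 \<le> N" and mono: "strict_mono_on {0..N} a"
    and C2: "\<And>i. i \<in> {1..N} \<Longrightarrow> C2_on {a 0..a N} (\<delta> i)"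
    and img: "\<And>i. i \<in> {1..N} \<Longrightarrow> \<delta> i ` {a 0..a N} = {a (i - 1)..a i}"
    and dsum: "\<And>t. t \<in> {a 0..a N} \<Longrightarrow> (\<Sum>i=1..N. deriv_within (\<delta> i) {a 0..a N} t) = 1"
    and dnn: "\<And>i t. i \<in> {1..N} \<Longrightarrow> t \<in> {a 0..a N} \<Longrightarrow> 0 \<le> deriv_within (\<delta> i) {a 0..a N} t"
    and ends: "\<And>i. i \<in> {1..N} \<Longrightarrow> \<delta> i (a 0) = a (i - 1) \<and> \<delta> i (a N) = a i"
    using P unfolding P_configuration_def by blast+
  have less: "a 0 < a N" using strict_mono_onD[OF mono, of 0 N] N by simp
  have amono: "a i \<le> a j" if "i \<le> j" "j \<le> N" for i j
    using strict_mono_onD[OF mono, of i j] that by (cases "i = j") auto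
  obtain p q where pq: "\<And>i. i \<in> {1..N} \<Longrightarrow>
      (\<forall>t\<in>{a 0..a N}. (\<delta> i has_real_derivative p i t) (at t within {a 0..a N})) \<and>
      (\<forall>t\<in>{a 0..a N}. (p i has_real_derivative q i t) (at t within {a 0..a N})) \<and>
      continuous_on {a 0..a N} (q i)"
    using C2 unfolding C2_on_def by metis
  have p: "deriv_within (\<delta> i) {a 0..a N} t = p i t" if "i \<in> {1..N}" "t \<in> {a 0..a N}" for i t
    using deriv_within_eq[OF less that(2)] pq that by blast
  have guiding: "t \<in> guiding_set {a 0..a N} \<delta> i \<longleftrightarrow> p i t = 0" if "i \<in> {1..N}" "t \<in> {a 0..a N}" for i t
    using p[OF that] that by (simp add: guiding_set_def)
  have attr: "t0 \<in> Z" if "closed Z" "Z \<subseteq> {a 0..a N}" "Z \<noteq> {}"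
      "\<And>t i. t \<in> Z \<Longrightarrow> i \<in> {1..N} \<Longrightarrow> p i t \<noteq> 0 \<Longrightarrow> \<delta> i t \<in> Z" for Z
    by (rule weak_attractor_in_closed_invariant[OF w that(1-3)]) (use that(2,4) guiding in blast)
  have "N \<noteq> 1"
  proof
    \<comment> \<open>For \<open>N = 1\<close> both endpoints are fixed, so the attractor would have to equal each of them.\<close>
    assume "N = 1"
    then have "t0 \<in> {a j}" if "j \<in> {0, 1}" for j
      using ends[of 1] less that by (intro attr) auto
    from this[of 0] this[of 1] show False using less \<open>N = 1\<close> by simp
  qed
  have "branching_config (a 0) (a N) {1..N} \<delta> p q t0"
  proof
    show "\<delta> i t \<in> {a 0..a N}" if "i \<in> {1..N}" "t \<in> {a 0..a N}" for i t
    proof -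
      have "\<delta> i t \<in> {a (i - 1)..a i}" using img[OF that(1)] that(2) by blast
      then show ?thesis using amono[of 0 "i - 1"] amono[of i N] that(1) by force
    qed
    \<comment> \<open>The branches map the interval onto adjacent pieces, endpoints to endpoints, so
      the sum telescopes along \<open>a\<close>.\<close>
    show "(\<Sum>i\<in>{1..N}. F (\<delta> i (a N)) - F (\<delta> i (a 0))) = F (a N) - F (a 0)" for F :: "real \<Rightarrow> real"
    proof -
      have "(\<Sum>i\<in>{1..N}. F (\<delta> i (a N)) - F (\<delta> i (a 0))) = (\<Sum>i\<in>{Suc 0..N}. F (a i) - F (a (i - 1)))"
        using ends by (intro sum.cong) auto
      then show ?thesis using sum_telescope''[of 0 N "\<lambda>i. F (a i)"] by simp
    qed
    show "0 < p i t0" if "i \<in> {1..N}" for i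
      using guiding[OF that, of t0] dnn[OF that, of t0] p[OF that, of t0] t0 that by force
    show "(\<Sum>i\<in>{1..N}. p i t) = 1" if "t \<in> {a 0..a N}" for t
      using dsum[OF that] p[OF _ that] by simp
    show "0 \<le> p i t" if "i \<in> {1..N}" "t \<in> {a 0..a N}" for i t
      using dnn[OF that] p[OF that] by simp
    show "2 \<le> card {1..N}" using N \<open>N \<noteq> 1\<close> by simp
    show "t0 \<in> Z" if "closed Z" "Z \<subseteq> {a 0..a N}" "Z \<noteq> {}"
      "\<And>t i. t \<in> Z \<Longrightarrow> i \<in> {1..N} \<Longrightarrow> p i t \<noteq> 0 \<Longrightarrow> \<delta> i t \<in> Z" for Z
      by (rule attr[OF that])
    show "(\<delta> i has_real_derivative p i t) (at t within {a 0..a N})"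
      "(p i has_real_derivative q i t) (at t within {a 0..a N})"
      if "i \<in> {1..N}" "t \<in> {a 0..a N}" for i t
      using pq[OF that(1)] that(2) by blast+
    show "continuous_on {a 0..a N} (q i)" if "i \<in> {1..N}" for i
      using pq[OF that] by blast
  qed (use less pq in simp_all)
  then show ?thesis by blast
qed

theorem theorem2p3p5:
  fixes N :: nat and a :: "nat \<Rightarrow> real" and \<delta> :: "nat \<Rightarrow> real \<Rightarrow> real"
    and I :: "real set" and \<Lambda> :: "nat \<Rightarrow> real set"
    and h :: "real \<Rightarrow> real" and \<mu> c :: real
  assumes "P_configuration N a \<delta>"
    and "I = {a 0..a N}"
    and "\<Lambda> = guiding_set I \<delta>"
    and "\<exists>t0 \<in> I - (\<Union>i\<in>{1..N}. \<Lambda> i). weak_attractor I N \<delta> \<Lambda> t0"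
    and "C2_on I h"
    and "h (a 0) = h (a N)"
    and "c \<in> I"
  shows "\<exists>!f. f \<in> extensional I \<and> C2_on I f \<and>
           (\<forall>t\<in>I. f t - (\<Sum>i=1..N. f (\<delta> i t)) = h t) \<and>
           deriv_within f I c = \<mu>"
proof -
  obtain t0 where "t0 \<in> I - (\<Union>i\<in>{1..N}. \<Lambda> i)" "weak_attractor I N \<delta> \<Lambda> t0"
    using assms(4) by (rule bexE)
  then obtain p q where "branching_config (a 0) (a N) {1..N} \<delta> p q t0"
    using P_configuration_branching_config[OF assms(1)] unfolding assms(2,3) by metis
  then interpret branching_config "a 0" "a N" "{1..N}" \<delta> p q t0 .
  have c: "c \<in> {a 0..a N}" using assms(2,7) by simp
  obtain h' h'' where h: "\<And>t. t \<in> {a 0..a N} \<Longrightarrow> (h has_real_derivative h' t) (at t within {a 0..a N})"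
    "\<And>t. t \<in> {a 0..a N} \<Longrightarrow> (h' has_real_derivative h'' t) (at t within {a 0..a N})"
    "continuous_on {a 0..a N} h''"
    using assms(2,5) unfolding C2_on_def by blast
  obtain f f' f'' where f: "\<And>t. t \<in> {a 0..a N} \<Longrightarrow> (f has_real_derivative f' t) (at t within {a 0..a N})"
    "\<And>t. t \<in> {a 0..a N} \<Longrightarrow> (f' has_real_derivative f'' t) (at t within {a 0..a N})"
    "continuous_on {a 0..a N} f''"
    "\<And>t. t \<in> {a 0..a N} \<Longrightarrow> f t - (\<Sum>i\<in>{1..N}. f (\<delta> i t)) = h t" "f' c = \<mu>"
    using functional_equation_exists[OF h assms(6), of c \<mu>] by blast
  \<comment> \<open>Fixing the values outside the interval makes uniqueness meaningful for total
    functions.\<close>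
  define F where "F = restrict f {a 0..a N}"
  have F_deriv: "(F has_real_derivative f' t) (at t within {a 0..a N})" if "t \<in> {a 0..a N}" for t
    by (rule has_field_derivative_transform_within[OF f(1)[OF that] zero_less_one that])
      (simp add: F_def)
  show ?thesis
    unfolding assms(2)
  proof (rule ex1I[of _ F], intro conjI ballI)
    show "F \<in> extensional {a 0..a N}" by (simp add: F_def)
    show "C2_on {a 0..a N} F" unfolding C2_on_def using F_deriv f(2,3) by blast
    show "F t - (\<Sum>i=1..N. F (\<delta> i t)) = h t" if "t \<in> {a 0..a N}" for t
    proof -
      have "(\<Sum>i=1..N. F (\<delta> i t)) = (\<Sum>i=1..N. f (\<delta> i t))"
        unfolding F_def by (intro sum.cong refl restrict_apply') (use d_in that in blast)
      then show ?thesis using f(4)[OF that] that by (simp add: F_def)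
    qed
    show "deriv_within F {a 0..a N} c = \<mu>"
      using deriv_within_eq[OF lo_less_hi c F_deriv[OF c]] f(5) by simp
    fix g assume g: "g \<in> extensional {a 0..a N} \<and> C2_on {a 0..a N} g \<and>
      (\<forall>t\<in>{a 0..a N}. g t - (\<Sum>i=1..N. g (\<delta> i t)) = h t) \<and> deriv_within g {a 0..a N} c = \<mu>"
    then obtain g' g'' where g': "\<And>t. t \<in> {a 0..a N} \<Longrightarrow> (g has_real_derivative g' t) (at t within {a 0..a N})"
      "\<And>t. t \<in> {a 0..a N} \<Longrightarrow> (g' has_real_derivative g'' t) (at t within {a 0..a N})"
      unfolding C2_on_def by blast
    \<comment> \<open>The difference of two solutions solves the homogeneous equation and has
      derivative 0 at \<open>c\<close>.\<close>
    have "g t - f t = 0" if t: "t \<in> {a 0..a N}" for t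
    proof (rule functional_equation_homogeneous[OF _ _ _ c _ t])
      show "((\<lambda>t. g t - f t) has_real_derivative g' t - f' t) (at t within {a 0..a N})"
        if "t \<in> {a 0..a N}" for t
        by (rule DERIV_diff[OF g'(1)[OF that] f(1)[OF that]])
      show "continuous_on {a 0..a N} (\<lambda>t. g' t - f' t)"
        by (intro continuous_on_diff DERIV_continuous_on[OF g'(2)] DERIV_continuous_on[OF f(2)])
      show "g t - f t - (\<Sum>i\<in>{1..N}. g (\<delta> i t) - f (\<delta> i t)) = 0" if "t \<in> {a 0..a N}" for t
        using f(4)[OF that] g that by (simp add: sum_subtractf algebra_simps)
      show "g' c - f' c = 0"
        using deriv_within_eq[OF lo_less_hi c g'(1)[OF c]] g f(5) by simp
    qed
    then show "g = F"
      using g unfolding F_def by (intro extensionalityI[of g "{a 0..a N}"]) auto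
  qed
qed

end
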